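(* Let $X$ be a connected finite $1$-dimensional cellular stratified space and $k$ a positive integer. Let $C(\pi^{\mathrm{comp}}_{k,X})$ be the face category of the stratification on $\mathrm{Conf}_k(X)$ induced by the braid stratification on $X^k$. Then $$\dim BC\left(\pi^{\mathrm{comp}}_{k,X}\right)\le v(X),$$ where $v(X)$ is the number of $0$-cells in $X$.
   Context: Configuration space: $\mathrm{Conf}_k(X)=\{(x_1,\dots,x_k)\in X^k : x_i\neq x_j \text{ for } i\ne j\}$. Cellular stratified spaces. A stratification on a space $X$ indexed by a poset $\Lambda$ is a map $\pi:X\to\Lambda$ such that $\lambda\le\mu$ iff $\pi^{-1}(\lambda)\subset\overline{\pi^{-1}(\mu)}$, and each stratum $e_\lambda=\pi^{-1}(\lambda)$ is connected and locally closed. For $X$ Hausdorff, an $n$-cell structure on $e_\lambda$ is a pair $(D_\lambda,\varphi_\lambda)$ with $\mathrm{Int}(D^n)\subset D_\lambda\subset D^n$ (unit disk) and $\varphi_\lambda:D_\lambda\to \overline{e_\lambda}\subset X$ a surjective quotient map onto $\overline{e_\lambda}$ restricting to a homeomorphism $\mathrm{Int}(D^n)\to e_\lambda$. A cellular stratification is a stratification with a cell structure on each stratum such that for every $n$-cell $e_\lambda$ the set $\overline{e_\lambda}\setminus e_\lambda$ is covered by finitely many cells of dimension $\le n-1$; then $X$ is a cellular stratified space. It is finite if it has finitely many cells. It is $1$-dimensional if its cells have dimension at most $1$ (and dimension $1$ occurs); the domain of a $1$-cell is $[-1,1]$ with some (possibly no) endpoints removed. Face category. The face category $C(Y)$ of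 a (totally normal) cellular stratified space $Y$ has the cells as objects; a morphism from $e_\mu$ to $e_\lambda$ is a map $b:D_\mu\to D_\lambda$ with $\varphi_\lambda\circ b=\varphi_\mu$; composition is composition of maps. $BC$ denotes the geometric realization of the nerve of a small category $C$, a cell complex with one $n$-cell for each chain of $n$ composable non-identity morphisms when $C$ is acyclic; $\dim BC$ is its dimension. Braid stratification. $X^k$ has the product stratification with cells $e_{\lambda_1}\times\cdots\times e_{\lambda_k}$ and characteristic maps $\varphi_{\lambda_1}\times\cdots\times\varphi_{\lambda_k}$ on $D_{\lambda_1}\times\cdots\times D_{\lambda_k}$. The braid stratification $\pi^{\mathrm{braid}}_{k,X}$ subdivides each product cell as follows: for each $1$-cell $e_\mu$ of $X$ let $I_\mu=\{i: e_{\lambda_i}=e_\mu\}$ and write the coordinates as $x_i=\varphi_\mu(t_i)$, $t_i\in(-1,1)$, $i\in I_\mu$; the product cell is cut by all hyperplanes $t_i=t_j$ ($i,j\in I_\mu$, $i\ne j$). Thus its cells are indexed by a product cell together with, for every $1$-cell $e_\mu$, an ordered partition of $I_\mu$ (recording the equalities and strict inequalities among the $t_i$). The domain of the characteristic map of such a cell is the subset of $D_{\lambda_1}\times\cdots\times D_{\lambda_k}$ given by the corresponding equalities and weak inequalities (a convex polytope with some faces removed, identified with a subspace of a disk by a homeomorphism), and the characteristic map is the restriction of the product characteristic map. $\pi^{\mathrm{comp}}_{k,X}$ is the restriction of $\pi^{\mathrm{braid}}_{k,X}$ to $\mathrm{Conf}_k(X)$, which is a union of cells; domains are restricted to the preimage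 of $\mathrm{Conf}_k(X)$. *)

theory Defs
  imports "HOL-Homology.Simplices" "HOL-Library.Extended_Nat" "HOL-Library.Disjoint_Sets"
begin

section \<open>Cellular stratified spaces\<close>

definition unit_disk :: "nat \<Rightarrow> (nat \<Rightarrow> real) set" where
  "unit_disk n = {x \<in> topspace (Euclidean_space n). (\<Sum>i<n. (x i)\<^sup>2) \<le> 1}"

definition open_unit_disk :: "nat \<Rightarrow> (nat \<Rightarrow> real) set" where
  "open_unit_disk n = {x \<in> topspace (Euclidean_space n). (\<Sum>i<n. (x i)\<^sup>2) < 1}"

text \<open>
  The data of a stratified space whose strata carry characteristic maps. Strata are named by
  elements of \<open>ss_index\<close>; \<open>ss_order\<close> is the relation \<open>\<le>\<close> on the index set. The domain of a
  characteristic map is an arbitrary space of type \<open>'d\<close>, so that a convex polytope with some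
  faces removed may serve as the domain of a cell without choosing a homeomorphism onto a
  subspace of a disk.
\<close>

record ('a, 'l, 'd) stratified_space =
  ss_space :: "'a topology"
  ss_index :: "'l set"
  ss_order :: "'l rel"
  ss_map :: "'a \<Rightarrow> 'l"
  ss_dim :: "'l \<Rightarrow> nat"
  ss_dom :: "'l \<Rightarrow> 'd topology"
  ss_char :: "'l \<Rightarrow> 'd \<Rightarrow> 'a"

definition stratum :: "('a, 'l, 'd) stratified_space \<Rightarrow> 'l \<Rightarrow> 'a set" where
  "stratum S l = {x \<in> topspace (ss_space S). ss_map S x = l}"

definition locally_closed_in :: "'a topology \<Rightarrow> 'a set \<Rightarrow> bool" where
  "locally_closed_in X A \<longleftrightarrow> (\<exists>U C. openin X U \<and> closedin X C \<and> A = U \<inter> C)"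

definition stratification :: "('a, 'l, 'd) stratified_space \<Rightarrow> bool" where
  "stratification S \<longleftrightarrow>
     ss_map S \<in> topspace (ss_space S) \<rightarrow> ss_index S \<and>
     partial_order_on (ss_index S) (ss_order S) \<and>
     (\<forall>l\<in>ss_index S. \<forall>m\<in>ss_index S.
        (l, m) \<in> ss_order S \<longleftrightarrow> stratum S l \<subseteq> ss_space S closure_of stratum S m) \<and>
     (\<forall>l\<in>ss_index S. connectedin (ss_space S) (stratum S l) \<and>
        locally_closed_in (ss_space S) (stratum S l))"

definition cell_structure ::
    "'a topology \<Rightarrow> 'a set \<Rightarrow> nat \<Rightarrow> (nat \<Rightarrow> real) topology \<Rightarrow> ((nat \<Rightarrow> real) \<Rightarrow> 'a) \<Rightarrow> bool" where
  "cell_structure X e n D \<phi> \<longleftrightarrow>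
     (\<exists>B. open_unit_disk n \<subseteq> B \<and> B \<subseteq> unit_disk n \<and> D = subtopology (Euclidean_space n) B) \<and>
     quotient_map D (subtopology X (X closure_of e)) \<phi> \<and>
     homeomorphic_map (subtopology (Euclidean_space n) (open_unit_disk n)) (subtopology X e) \<phi>"

definition cellular_stratified_space :: "('a, 'l, nat \<Rightarrow> real) stratified_space \<Rightarrow> bool" where
  "cellular_stratified_space S \<longleftrightarrow>
     Hausdorff_space (ss_space S) \<and>
     stratification S \<and>
     (\<forall>l\<in>ss_index S.
        cell_structure (ss_space S) (stratum S l) (ss_dim S l) (ss_dom S l) (ss_char S l)) \<and>
     (\<forall>l\<in>ss_index S. \<exists>F. finite F \<and> F \<subseteq> ss_index S \<and> (\<forall>m\<in>F. ss_dim S m < ss_dim S l) \<and>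
        ss_space S closure_of stratum S l - stratum S l \<subseteq> (\<Union>m\<in>F. stratum S m))"

definition cells_of_dim :: "('a, 'l, 'd) stratified_space \<Rightarrow> nat \<Rightarrow> 'l set" where
  "cells_of_dim S n = {l \<in> ss_index S. ss_dim S l = n}"

definition finite_stratified :: "('a, 'l, 'd) stratified_space \<Rightarrow> bool" where
  "finite_stratified S \<longleftrightarrow> finite (ss_index S)"

definition one_dimensional :: "('a, 'l, 'd) stratified_space \<Rightarrow> bool" where
  "one_dimensional S \<longleftrightarrow> (\<forall>l\<in>ss_index S. ss_dim S l \<le> 1) \<and> cells_of_dim S 1 \<noteq> {}"

definition num_vertices :: "('a, 'l, 'd) stratified_space \<Rightarrow> nat" where
  "num_vertices S = card (cells_of_dim S 0)"

definition restrict_stratification ::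
    "('a, 'l, 'd) stratified_space \<Rightarrow> 'a set \<Rightarrow> ('a, 'l, 'd) stratified_space" where
  "restrict_stratification S A =
     (let I = {l \<in> ss_index S. stratum S l \<inter> A \<noteq> {}} in
      \<lparr> ss_space = subtopology (ss_space S) A,
        ss_index = I,
        ss_order = ss_order S \<inter> (I \<times> I),
        ss_map = ss_map S,
        ss_dim = ss_dim S,
        ss_dom = (\<lambda>l. subtopology (ss_dom S l) {t. ss_char S l t \<in> A}),
        ss_char = ss_char S \<rparr>)"


section \<open>The braid stratification\<close>

text \<open>
  Throughout, \<open>X\<close> is one-dimensional, points of \<open>X\<^sup>k\<close> are functions on \<open>{..<k}\<close>, and the
  parameter of a point of a 1-cell is the coordinate with index 0 of its preimage in
  \<open>open_unit_disk 1\<close>.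
\<close>

definition power_space :: "nat \<Rightarrow> 'a topology \<Rightarrow> (nat \<Rightarrow> 'a) topology" where
  "power_space k X = product_topology (\<lambda>_. X) {..<k}"

definition Conf :: "nat \<Rightarrow> 'a topology \<Rightarrow> (nat \<Rightarrow> 'a) set" where
  "Conf k X = {x \<in> topspace (power_space k X). \<forall>i<k. \<forall>j<k. i \<noteq> j \<longrightarrow> x i \<noteq> x j}"

definition ordered_partitions :: "'b set \<Rightarrow> 'b set list set" where
  "ordered_partitions I = {bs. partition_on I (set bs) \<and> distinct bs}"

text \<open>
  A braid cell is a product cell \<open>c\<close> together with an ordered partition \<open>P m\<close> of
  \<open>{i. c i = m}\<close> for every 1-cell \<open>m\<close>; the parameter is constant on each block and increases
  from one block to the next.
\<close>

type_synonym 'l braid_cell = "(nat \<Rightarrow> 'l) \<times> ('l \<Rightarrow> nat set list)"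

definition braid_index :: "nat \<Rightarrow> ('a, 'l, 'd) stratified_space \<Rightarrow> 'l braid_cell set" where
  "braid_index k X =
     (SIGMA c : {..<k} \<rightarrow>\<^sub>E ss_index X.
        \<Pi>\<^sub>E m\<in>cells_of_dim X 1. ordered_partitions {i \<in> {..<k}. c i = m})"

definition edge_param ::
    "('a, 'l, nat \<Rightarrow> real) stratified_space \<Rightarrow> 'l \<Rightarrow> 'a \<Rightarrow> real" where
  "edge_param X m x = the_inv_into (open_unit_disk 1) (ss_char X m) x 0"

definition braid_map ::
    "nat \<Rightarrow> ('a, 'l, nat \<Rightarrow> real) stratified_space \<Rightarrow> (nat \<Rightarrow> 'a) \<Rightarrow> 'l braid_cell" where
  "braid_map k X x =
     (\<lambda>i\<in>{..<k}. ss_map X (x i),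
      \<lambda>m\<in>cells_of_dim X 1.
        let I = {i \<in> {..<k}. ss_map X (x i) = m} in
        map (\<lambda>s. {i \<in> I. edge_param X m (x i) = s})
            (sorted_list_of_set ((\<lambda>i. edge_param X m (x i)) ` I)))"

lemma braid_map_in_braid_index:
  assumes "ss_map X \<in> topspace (ss_space X) \<rightarrow> ss_index X"
    and "x \<in> topspace (power_space k (ss_space X))"
  shows "braid_map k X x \<in> braid_index k X"
proof -
  have "map (\<lambda>s. {i \<in> I. f i = s}) (sorted_list_of_set (f ` I)) \<in> ordered_partitions I"
    if "finite I" for I :: "nat set" and f :: "nat \<Rightarrow> real"
    using that
    by (auto simp: ordered_partitions_def partition_on_def disjoint_def distinct_map inj_on_def)
  moreover have "{i \<in> {..<k}. (\<lambda>i\<in>{..<k}. ss_map X (x i)) i = m}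
      = {i \<in> {..<k}. ss_map X (x i) = m}" for m
    by auto
  ultimately show ?thesis
    using assms
    by (auto simp: braid_map_def braid_index_def power_space_def Let_def PiE_def simp del: mem_Collect_eq)
qed

text \<open>
  The case \<open>a = b\<close> of the condition below gives the equality of the parameters in a block.
\<close>

definition braid_dom ::
    "nat \<Rightarrow> ('a, 'l, nat \<Rightarrow> real) stratified_space \<Rightarrow> 'l braid_cell \<Rightarrow> (nat \<Rightarrow> nat \<Rightarrow> real) topology"
  where
  "braid_dom k X = (\<lambda>(c, P).
     subtopology (product_topology (\<lambda>i. ss_dom X (c i)) {..<k})
       {t. \<forall>m\<in>cells_of_dim X 1. \<forall>a b. a \<le> b \<and> b < length (P m) \<longrightarrow>
             (\<forall>i\<in>P m ! a. \<forall>j\<in>P m ! b. t i 0 \<le> t j 0)})"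

definition braid_char ::
    "nat \<Rightarrow> ('a, 'l, nat \<Rightarrow> real) stratified_space \<Rightarrow> 'l braid_cell \<Rightarrow> (nat \<Rightarrow> nat \<Rightarrow> real) \<Rightarrow> (nat \<Rightarrow> 'a)"
  where
  "braid_char k X = (\<lambda>(c, P) t. \<lambda>i\<in>{..<k}. ss_char X (c i) (t i))"

text \<open>A braid cell has one degree of freedom for each block.\<close>

definition braid_dim :: "('a, 'l, 'd) stratified_space \<Rightarrow> 'l braid_cell \<Rightarrow> nat" where
  "braid_dim X = (\<lambda>(c, P). \<Sum>m\<in>cells_of_dim X 1. length (P m))"

definition braid_order ::
    "nat \<Rightarrow> ('a, 'l, nat \<Rightarrow> real) stratified_space \<Rightarrow> 'l braid_cell rel" where
  "braid_order k X =
     {(p, q) \<in> braid_index k X \<times> braid_index k X.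
        let Y = power_space k (ss_space X);
            e = (\<lambda>r. {x \<in> topspace Y. braid_map k X x = r})
        in e p \<subseteq> Y closure_of e q}"

definition braid_stratification ::
    "nat \<Rightarrow> ('a, 'l, nat \<Rightarrow> real) stratified_space
      \<Rightarrow> (nat \<Rightarrow> 'a, 'l braid_cell, nat \<Rightarrow> nat \<Rightarrow> real) stratified_space" where
  "braid_stratification k X =
     \<lparr> ss_space = power_space k (ss_space X),
       ss_index = braid_index k X,
       ss_order = braid_order k X,
       ss_map = braid_map k X,
       ss_dim = braid_dim X,
       ss_dom = braid_dom k X,
       ss_char = braid_char k X \<rparr>"

definition comp_stratification ::
    "nat \<Rightarrow> ('a, 'l, nat \<Rightarrow> real) stratified_space
      \<Rightarrow> (nat \<Rightarrow> 'a, 'l braid_cell, nat \<Rightarrow> nat \<Rightarrow> real) stratified_space" where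
  "comp_stratification k X =
     restrict_stratification (braid_stratification k X) (Conf k (ss_space X))"


section \<open>Small categories and their classifying spaces\<close>

record ('o, 'm) cat =
  cat_obj :: "'o set"
  cat_arr :: "'m set"
  cat_src :: "'m \<Rightarrow> 'o"
  cat_tgt :: "'m \<Rightarrow> 'o"
  cat_id :: "'o \<Rightarrow> 'm"
  cat_comp :: "'m \<Rightarrow> 'm \<Rightarrow> 'm"

definition cat_hom :: "('o, 'm) cat \<Rightarrow> 'o \<Rightarrow> 'o \<Rightarrow> 'm set" where
  "cat_hom C a b = {f \<in> cat_arr C. cat_src C f = a \<and> cat_tgt C f = b}"

definition small_category :: "('o, 'm) cat \<Rightarrow> bool" where
  "small_category C \<longleftrightarrow>
     (\<forall>f\<in>cat_arr C. cat_src C f \<in> cat_obj C \<and> cat_tgt C f \<in> cat_obj C) \<and>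
     (\<forall>a\<in>cat_obj C. cat_id C a \<in> cat_hom C a a) \<and>
     (\<forall>a\<in>cat_obj C. \<forall>b\<in>cat_obj C. \<forall>c\<in>cat_obj C. \<forall>f\<in>cat_hom C a b. \<forall>g\<in>cat_hom C b c.
        cat_comp C g f \<in> cat_hom C a c) \<and>
     (\<forall>a\<in>cat_obj C. \<forall>b\<in>cat_obj C. \<forall>f\<in>cat_hom C a b.
        cat_comp C f (cat_id C a) = f \<and> cat_comp C (cat_id C b) f = f) \<and>
     (\<forall>a\<in>cat_obj C. \<forall>b\<in>cat_obj C. \<forall>c\<in>cat_obj C. \<forall>d\<in>cat_obj C.
        \<forall>f\<in>cat_hom C a b. \<forall>g\<in>cat_hom C b c. \<forall>h\<in>cat_hom C c d.
        cat_comp C h (cat_comp C g f) = cat_comp C (cat_comp C h g) f)"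

text \<open>
  An \<open>n\<close>-simplex of the nerve is a functor from the ordered set \<open>{0, \<dots>, n}\<close>, given by its
  values on the arrows \<open>i \<le> j\<close>. Simplicial operators act by precomposition.
\<close>

definition ord_arrows :: "nat \<Rightarrow> (nat \<times> nat) set" where
  "ord_arrows n = {(i, j). i \<le> j \<and> j \<le> n}"

definition nerve :: "('o, 'm) cat \<Rightarrow> nat \<Rightarrow> (nat \<times> nat \<Rightarrow> 'm) set" where
  "nerve C n = {\<sigma> \<in> extensional (ord_arrows n). \<exists>a.
     (\<forall>i\<le>n. a i \<in> cat_obj C \<and> \<sigma> (i, i) = cat_id C (a i)) \<and>
     (\<forall>i j. i \<le> j \<and> j \<le> n \<longrightarrow> \<sigma> (i, j) \<in> cat_hom C (a i) (a j)) \<and>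
     (\<forall>i j l. i \<le> j \<and> j \<le> l \<and> l \<le> n \<longrightarrow> \<sigma> (i, l) = cat_comp C (\<sigma> (j, l)) (\<sigma> (i, j)))}"

definition ord_maps :: "nat \<Rightarrow> nat \<Rightarrow> (nat \<Rightarrow> nat) set" where
  "ord_maps m n = {\<theta>. \<theta> \<in> {..m} \<rightarrow> {..n} \<and> mono_on {..m} \<theta>}"

definition nerve_op :: "nat \<Rightarrow> (nat \<Rightarrow> nat) \<Rightarrow> (nat \<times> nat \<Rightarrow> 'm) \<Rightarrow> (nat \<times> nat \<Rightarrow> 'm)" where
  "nerve_op m \<theta> \<sigma> = (\<lambda>(i, j)\<in>ord_arrows m. \<sigma> (\<theta> i, \<theta> j))"

definition degenerate :: "('o, 'm) cat \<Rightarrow> nat \<Rightarrow> (nat \<times> nat \<Rightarrow> 'm) \<Rightarrow> bool" where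
  "degenerate C n \<sigma> \<longleftrightarrow>
     (\<exists>m<n. \<exists>\<tau>\<in>nerve C m. \<exists>\<theta>\<in>ord_maps n m. \<theta> ` {..n} = {..m} \<and> \<sigma> = nerve_op n \<theta> \<tau>)"

definition simplex_push :: "nat \<Rightarrow> (nat \<Rightarrow> nat) \<Rightarrow> (nat \<Rightarrow> real) \<Rightarrow> (nat \<Rightarrow> real)" where
  "simplex_push m \<theta> t = (\<lambda>j. \<Sum>i | i \<le> m \<and> \<theta> i = j. t i)"

type_synonym 'm nerve_point = "(nat \<times> (nat \<times> nat \<Rightarrow> 'm)) \<times> (nat \<Rightarrow> real)"

definition nerve_coproduct :: "('o, 'm) cat \<Rightarrow> 'm nerve_point topology" where
  "nerve_coproduct C =
     sum_topology (\<lambda>(n, \<sigma>). subtopology (powertop_real UNIV) (standard_simplex n))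
       {(n, \<sigma>). \<sigma> \<in> nerve C n}"

definition nerve_gluing :: "('o, 'm) cat \<Rightarrow> 'm nerve_point rel" where
  "nerve_gluing C =
     {(((m, nerve_op m \<theta> \<sigma>), t), ((n, \<sigma>), simplex_push m \<theta> t)) | m n \<theta> \<sigma> t.
        \<sigma> \<in> nerve C n \<and> \<theta> \<in> ord_maps m n \<and> t \<in> standard_simplex m}"

definition BC_class :: "('o, 'm) cat \<Rightarrow> 'm nerve_point \<Rightarrow> 'm nerve_point set" where
  "BC_class C p = (nerve_gluing C \<union> (nerve_gluing C)\<inverse>)\<^sup>* `` {p}"

definition BC :: "('o, 'm) cat \<Rightarrow> 'm nerve_point set topology" where
  "BC C = topology (\<lambda>U. U \<subseteq> BC_class C ` topspace (nerve_coproduct C) \<and>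
     openin (nerve_coproduct C) {p \<in> topspace (nerve_coproduct C). BC_class C p \<in> U})"

lemma quotient_map_BC: "quotient_map (nerve_coproduct C) (BC C) (BC_class C)"
proof -
  let ?X = "nerve_coproduct C" and ?q = "BC_class C"
  let ?P = "\<lambda>U. U \<subseteq> ?q ` topspace ?X \<and> openin ?X {p \<in> topspace ?X. ?q p \<in> U}"
  have "istopology ?P"
    unfolding istopology_def
  proof (intro conjI allI impI)
    fix S T assume "?P S" "?P T"
    then have "openin ?X ({p \<in> topspace ?X. ?q p \<in> S} \<inter> {p \<in> topspace ?X. ?q p \<in> T})"
      by blast
    moreover have "{p \<in> topspace ?X. ?q p \<in> S} \<inter> {p \<in> topspace ?X. ?q p \<in> T}
        = {p \<in> topspace ?X. ?q p \<in> S \<inter> T}" by auto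
    ultimately show "openin ?X {p \<in> topspace ?X. ?q p \<in> S \<inter> T}" by simp
    show "S \<inter> T \<subseteq> ?q ` topspace ?X" using \<open>?P S\<close> by auto
  next
    fix K assume K: "\<forall>S\<in>K. ?P S"
    then have "openin ?X (\<Union>S\<in>K. {p \<in> topspace ?X. ?q p \<in> S})" by blast
    moreover have "(\<Union>S\<in>K. {p \<in> topspace ?X. ?q p \<in> S}) = {p \<in> topspace ?X. ?q p \<in> \<Union>K}"
      by auto
    ultimately show "openin ?X {p \<in> topspace ?X. ?q p \<in> \<Union>K}" by simp
    show "\<Union>K \<subseteq> ?q ` topspace ?X" using K by auto
  qed
  then have o: "openin (BC C) U \<longleftrightarrow> ?P U" for U
    by (simp add: BC_def)
  have "{p \<in> topspace ?X. ?q p \<in> ?q ` topspace ?X} = topspace ?X" by auto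
  then have "?P (?q ` topspace ?X)" by simp
  then have "topspace (BC C) = ?q ` topspace ?X"
    unfolding topspace_def[of "BC C"] o by blast
  then show ?thesis by (auto simp: quotient_map_def o)
qed

text \<open>
  The open \<open>n\<close>-cells of the cell complex \<open>BC C\<close>: the images of the interiors of the simplices
  belonging to nondegenerate \<open>n\<close>-simplices of the nerve.
\<close>

definition BC_cells :: "('o, 'm) cat \<Rightarrow> nat \<Rightarrow> 'm nerve_point set set set" where
  "BC_cells C n =
     {BC_class C ` ({(n, \<sigma>)} \<times> {t \<in> standard_simplex n. \<forall>i\<le>n. 0 < t i}) | \<sigma>.
        \<sigma> \<in> nerve C n \<and> \<not> degenerate C n \<sigma>}"

definition dim_BC :: "('o, 'm) cat \<Rightarrow> enat" where
  "dim_BC C = Sup {enat n | n. BC_cells C n \<noteq> {}}"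


section \<open>The face category\<close>

text \<open>
  A morphism from \<open>m\<close> to \<open>l\<close> is a triple \<open>(m, l, b)\<close>, where \<open>b\<close> is continuous and is required to
  be extensional so that it is determined by its values on the domain of \<open>m\<close>.
\<close>

definition face_lifts :: "('a, 'l, 'd) stratified_space \<Rightarrow> 'l \<Rightarrow> 'l \<Rightarrow> ('d \<Rightarrow> 'd) set" where
  "face_lifts S m l =
     {b \<in> extensional (topspace (ss_dom S m)).
        continuous_map (ss_dom S m) (ss_dom S l) b \<and>
        (\<forall>t\<in>topspace (ss_dom S m). ss_char S l (b t) = ss_char S m t)}"

definition face_category ::
    "('a, 'l, 'd) stratified_space \<Rightarrow> ('l, 'l \<times> 'l \<times> ('d \<Rightarrow> 'd)) cat" where
  "face_category S =
     \<lparr> cat_obj = ss_index S,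
       cat_arr = {(m, l, b). m \<in> ss_index S \<and> l \<in> ss_index S \<and> b \<in> face_lifts S m l},
       cat_src = (\<lambda>(m, l, b). m),
       cat_tgt = (\<lambda>(m, l, b). l),
       cat_id = (\<lambda>l. (l, l, \<lambda>t\<in>topspace (ss_dom S l). t)),
       cat_comp = (\<lambda>(m', l', b') (m, l, b). (m, l', compose (topspace (ss_dom S m)) b' b)) \<rparr>"

lemma face_lifts_id: "(\<lambda>t\<in>topspace (ss_dom S l). t) \<in> face_lifts S l l"
proof -
  have "continuous_map (ss_dom S l) (ss_dom S l) (\<lambda>t\<in>topspace (ss_dom S l). t)"
    by (rule continuous_map_eq[OF continuous_map_id]) auto
  then show ?thesis by (auto simp: face_lifts_def)
qed

lemma face_lifts_compose:
  assumes "b \<in> face_lifts S m l" "b' \<in> face_lifts S l n"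
  shows "compose (topspace (ss_dom S m)) b' b \<in> face_lifts S m n"
proof -
  have "continuous_map (ss_dom S m) (ss_dom S n) (b' \<circ> b)"
    using assms by (auto simp: face_lifts_def intro: continuous_map_compose)
  then have "continuous_map (ss_dom S m) (ss_dom S n) (compose (topspace (ss_dom S m)) b' b)"
    by (rule continuous_map_eq) (auto simp: compose_def)
  moreover have "b t \<in> topspace (ss_dom S l)" if "t \<in> topspace (ss_dom S m)" for t
    using assms(1) that by (auto simp: face_lifts_def continuous_map_def)
  ultimately show ?thesis
    using assms by (auto simp: face_lifts_def compose_def)
qed

lemma small_category_face_category: "small_category (face_category S)"
proof -
  have into: "b t \<in> topspace (ss_dom S l)"
    if "b \<in> face_lifts S m l" "t \<in> topspace (ss_dom S m)" for b t m l
    using that by (auto simp: face_lifts_def continuous_map_def)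
  have ext: "b \<in> extensional (topspace (ss_dom S m))" if "b \<in> face_lifts S m l" for b m l
    using that by (auto simp: face_lifts_def)
  have unit: "compose (topspace (ss_dom S m)) b (\<lambda>t\<in>topspace (ss_dom S m). t) = b"
      "compose (topspace (ss_dom S m)) (\<lambda>t\<in>topspace (ss_dom S l). t) b = b"
    if "b \<in> face_lifts S m l" for b m l
    using into[OF that] ext[OF that] by (auto simp: compose_def fun_eq_iff extensional_def)
  have assoc: "compose (topspace (ss_dom S m)) b'' (compose (topspace (ss_dom S m)) b' b)
      = compose (topspace (ss_dom S m)) (compose (topspace (ss_dom S l)) b'' b') b"
    if "b \<in> face_lifts S m l" for b b' b'' m l
    using into[OF that] by (auto simp: compose_def fun_eq_iff)
  show ?thesis
    unfolding small_category_def cat_hom_def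
    by (auto simp: face_category_def face_lifts_id unit assoc intro: face_lifts_compose)
qed

end

theory Submission
  imports Defs "HOL-Analysis.Abstract_Topological_Spaces"
begin

text \<open>
  A nondegenerate simplex of the nerve is a chain of non-identity arrows, so it suffices to find a
  natural number attached to each cell of the configuration space, bounded by the number of
  vertices of \<open>X\<close>, which every non-identity morphism decreases. This number is the number of
  coordinates lying in 0-cells. Two coordinates never lie in the same 0-cell, which gives the bound.
  A morphism from one cell to another can only move coordinates from a 0-cell to a 1-cell, since
  \<open>X\<close> is one-dimensional. If it moves none, then both cells lie in the same product cell, and the
  lift fixes all interior points of the domain because characteristic maps are injective there. In
  particular the two orderings of the parameters agree, and by density the lift is the identity.
\<close>

section \<open>Nerve simplices and rank functions on a category\<close>

text \<open>The definition of \<open>nerve\<close> only asserts that a family of objects exists; the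
  source of the arrow at \<open>(i, i)\<close> recovers it canonically.\<close>

definition nerve_vertex :: "('o, 'm) cat \<Rightarrow> (nat \<times> nat \<Rightarrow> 'm) \<Rightarrow> nat \<Rightarrow> 'o" where
  "nerve_vertex C \<sigma> i = cat_src C (\<sigma> (i, i))"

lemma nerveD:
  assumes "\<sigma> \<in> nerve C n"
  shows "i \<le> n \<Longrightarrow> nerve_vertex C \<sigma> i \<in> cat_obj C"
    and "i \<le> n \<Longrightarrow> \<sigma> (i, i) = cat_id C (nerve_vertex C \<sigma> i)"
    and "i \<le> j \<Longrightarrow> j \<le> n \<Longrightarrow> \<sigma> (i, j) \<in> cat_hom C (nerve_vertex C \<sigma> i) (nerve_vertex C \<sigma> j)"
    and "i \<le> j \<Longrightarrow> j \<le> l \<Longrightarrow> l \<le> n \<Longrightarrow> \<sigma> (i, l) = cat_comp C (\<sigma> (j, l)) (\<sigma> (i, j))"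
    and "\<sigma> \<in> extensional (ord_arrows n)"
proof -
  from assms obtain a where
      a: "\<forall>i\<le>n. a i \<in> cat_obj C \<and> \<sigma> (i, i) = cat_id C (a i)"
        "\<forall>i j. i \<le> j \<and> j \<le> n \<longrightarrow> \<sigma> (i, j) \<in> cat_hom C (a i) (a j)"
        "\<forall>i j l. i \<le> j \<and> j \<le> l \<and> l \<le> n \<longrightarrow> \<sigma> (i, l) = cat_comp C (\<sigma> (j, l)) (\<sigma> (i, j))"
    and ext: "\<sigma> \<in> extensional (ord_arrows n)"
    unfolding nerve_def by (elim CollectE conjE exE)
  have v: "nerve_vertex C \<sigma> i = a i" if "i \<le> n" for i
    using a(2)[rule_format, of i i] that by (simp add: nerve_vertex_def cat_hom_def)
  show "i \<le> n \<Longrightarrow> nerve_vertex C \<sigma> i \<in> cat_obj C" using a(1) v by simp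
  show "i \<le> n \<Longrightarrow> \<sigma> (i, i) = cat_id C (nerve_vertex C \<sigma> i)" using a(1) v by simp
  show "\<sigma> (i, j) \<in> cat_hom C (nerve_vertex C \<sigma> i) (nerve_vertex C \<sigma> j)" if "i \<le> j" "j \<le> n"
    using a(2) v that by simp
  show "\<sigma> (i, l) = cat_comp C (\<sigma> (j, l)) (\<sigma> (i, j))" if "i \<le> j" "j \<le> l" "l \<le> n"
    using a(3)[rule_format, of i j l] that by blast
  show "\<sigma> \<in> extensional (ord_arrows n)" by (fact ext)
qed

lemma nerve_op_nerve:
  assumes "\<sigma> \<in> nerve C n" "\<theta> \<in> ord_maps m n"
  shows "nerve_op m \<theta> \<sigma> \<in> nerve C m"
proof -
  let ?a = "nerve_vertex C \<sigma>"
  note obj = nerveD(1)[OF assms(1)] and idt = nerveD(2)[OF assms(1)] and hom = nerveD(3)[OF assms(1)]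
    and comp = nerveD(4)[OF assms(1)]
  have le: "\<theta> i \<le> n" if "i \<le> m" for i using assms(2) that by (auto simp: ord_maps_def)
  have mono: "\<theta> i \<le> \<theta> j" if "i \<le> j" "j \<le> m" for i j
    using assms(2) that by (auto simp: ord_maps_def mono_on_def)
  show ?thesis
    unfolding nerve_def
  proof (intro CollectI conjI exI[of _ "?a \<circ> \<theta>"] allI impI)
    show "nerve_op m \<theta> \<sigma> \<in> extensional (ord_arrows m)" by (simp add: nerve_op_def)
  next
    fix i j l assume "i \<le> j \<and> j \<le> l \<and> l \<le> m"
    then show "nerve_op m \<theta> \<sigma> (i, l) = cat_comp C (nerve_op m \<theta> \<sigma> (j, l)) (nerve_op m \<theta> \<sigma> (i, j))"
      using comp[of "\<theta> i" "\<theta> j" "\<theta> l"] le mono by (simp add: nerve_op_def ord_arrows_def)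
  next
    fix i j assume "i \<le> j \<and> j \<le> m"
    then show "nerve_op m \<theta> \<sigma> (i, j) \<in> cat_hom C ((?a \<circ> \<theta>) i) ((?a \<circ> \<theta>) j)"
      using hom[of "\<theta> i" "\<theta> j"] le mono by (simp add: nerve_op_def ord_arrows_def)
  next
    fix i assume "i \<le> m"
    then show "(?a \<circ> \<theta>) i \<in> cat_obj C" "nerve_op m \<theta> \<sigma> (i, i) = cat_id C ((?a \<circ> \<theta>) i)"
      using obj[of "\<theta> i"] idt[of "\<theta> i"] le by (simp_all add: nerve_op_def ord_arrows_def)
  qed
qed

text \<open>If the edge from \<open>i\<close> to \<open>Suc i\<close> is an identity, the unit laws
  make \<sigma> blind to the difference between these two vertices. Hence \<sigma> is recovered from
  its face omitting \<open>Suc i\<close> by repeating vertex \<open>i\<close>.\<close>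

lemma nerve_unit_degenerate:
  assumes C: "small_category C" and \<sigma>: "\<sigma> \<in> nerve C n" and i: "i < n"
    and unit: "\<sigma> (i, Suc i) = \<sigma> (i, i)"
  shows "degenerate C n \<sigma>"
proof -
  \<comment> \<open>\<open>d\<close> is the injection that skips \<open>Suc i\<close>, and
    \<open>s\<close> is the surjection that takes the value \<open>i\<close> twice. The composite
    \<open>d (s x)\<close> moves only \<open>Suc i\<close>, to \<open>i\<close>.\<close>
  define d where "d = (\<lambda>j. if j \<le> i then j else Suc j)"
  define s where "s = (\<lambda>j. if j \<le> i then j else j - 1)"
  let ?a = "nerve_vertex C \<sigma>"
  note obj = nerveD(1)[OF \<sigma>] and idt = nerveD(2)[OF \<sigma>] and hom = nerveD(3)[OF \<sigma>]
    and comp = nerveD(4)[OF \<sigma>] and ext = nerveD(5)[OF \<sigma>]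
  have idl: "cat_comp C (cat_id C y) f = f" and idr: "cat_comp C f (cat_id C x) = f"
    if "x \<in> cat_obj C" "y \<in> cat_obj C" "f \<in> cat_hom C x y" for x y f
    using C that by (auto simp: small_category_def)
  \<comment> \<open>Equal arrows have equal targets. This is what makes the right unit law at vertex
    \<open>i\<close> applicable to \<open>\<sigma> (Suc i, j)\<close> in \<open>row\<close>.\<close>
  have same: "?a (Suc i) = ?a i"
    using hom[of i "Suc i"] hom[of i i] i unit by (auto simp: cat_hom_def)
  have col: "\<sigma> (j, Suc i) = \<sigma> (j, i)" if "j \<le> i" for j
    using comp[of j i "Suc i"] unit obj[of i] idt[of i] obj[of j] idl[of "?a j" "?a i" "\<sigma> (j, i)"] hom[of j i] i that
    by auto
  have row: "\<sigma> (Suc i, j) = \<sigma> (i, j)" if "Suc i \<le> j" "j \<le> n" for j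
    using comp[of i "Suc i" j] unit obj[of i] idt[of i] obj[of j] idr[of "?a i" "?a j" "\<sigma> (Suc i, j)"]
      hom[of "Suc i" j] i that same by auto
  have corner: "\<sigma> (Suc i, Suc i) = \<sigma> (i, i)" using row[of "Suc i"] unit i by simp
  have "d \<in> ord_maps (n - 1) n" "s \<in> ord_maps n (n - 1)"
    using i by (auto simp: ord_maps_def d_def s_def mono_on_def)
  moreover have "s ` {..n} = {..n - 1}"
  proof
    show "{..n - 1} \<subseteq> s ` {..n}"
    proof
      fix j assume "j \<in> {..n - 1}"
      then have "j = s (d j)" "d j \<in> {..n}" using i by (auto simp: s_def d_def)
      then show "j \<in> s ` {..n}" by blast
    qed
  qed (use i in \<open>auto simp: s_def\<close>)
  moreover have "\<sigma> = nerve_op n s (nerve_op (n - 1) d \<sigma>)"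
  proof
    fix p :: "nat \<times> nat"
    obtain j l where p: "p = (j, l)" by fastforce
    show "\<sigma> p = nerve_op n s (nerve_op (n - 1) d \<sigma>) p"
    proof (cases "j \<le> l \<and> l \<le> n")
      case True
      have ds: "d (s x) = (if x = Suc i then i else x)" for x by (auto simp: d_def s_def)
      have "s j \<le> s l" "s l \<le> n - 1" using True i by (auto simp: s_def)
      then have "nerve_op n s (nerve_op (n - 1) d \<sigma>) p = \<sigma> (d (s j), d (s l))"
        using True by (simp add: nerve_op_def ord_arrows_def p)
      also have "\<dots> = \<sigma> (j, l)"
        using True col[of j] row[of l] corner by (auto simp: ds)
      finally show ?thesis by (simp add: p)
    qed (use ext in \<open>auto simp: nerve_op_def ord_arrows_def p extensional_def\<close>)
  qed
  ultimately show ?thesis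
    unfolding degenerate_def using nerve_op_nerve[OF \<sigma>] i
    by (metis (no_types, lifting) diff_less gr_implies_not0 less_one neq0_conv)
qed

text \<open>Consecutive arrows of a nondegenerate simplex are not identities, so \<open>r\<close>
  drops strictly along its vertices. A chain of \<open>n\<close> drops in the natural numbers
  starting from at most \<open>v\<close> forces \<open>n \<le> v\<close>.\<close>

lemma dim_BC_le:
  fixes r :: "'o \<Rightarrow> nat"
  assumes C: "small_category C"
    and bound: "\<And>x. x \<in> cat_obj C \<Longrightarrow> r x \<le> v"
    and decr: "\<And>x y f. x \<in> cat_obj C \<Longrightarrow> y \<in> cat_obj C \<Longrightarrow> f \<in> cat_hom C x y \<Longrightarrow>
      r y < r x \<or> (x = y \<and> f = cat_id C x)"
  shows "dim_BC C \<le> enat v"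
  unfolding dim_BC_def
proof (rule Sup_least)
  fix z assume "z \<in> {enat n |n. BC_cells C n \<noteq> {}}"
  then obtain n \<sigma> where z: "z = enat n" and \<sigma>: "\<sigma> \<in> nerve C n" and nd: "\<not> degenerate C n \<sigma>"
    by (auto simp: BC_cells_def)
  let ?a = "nerve_vertex C \<sigma>"
  note obj = nerveD(1)[OF \<sigma>] and idt = nerveD(2)[OF \<sigma>] and hom = nerveD(3)[OF \<sigma>]
  have step: "r (?a (Suc i)) < r (?a i)" if "i < n" for i
    using decr[of "?a i" "?a (Suc i)" "\<sigma> (i, Suc i)"] obj[of i] obj[of "Suc i"] idt[of i] hom[of i "Suc i"]
      nerve_unit_degenerate[OF C \<sigma> that] nd that by fastforce
  \<comment> \<open>The drop is stated as a sum to avoid truncated subtraction of naturals.\<close>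
  have "r (?a i) + i \<le> r (?a 0)" if "i \<le> n" for i
    using that
  proof (induction i)
    case (Suc i)
    then show ?case using step[of i] by simp
  qed simp
  from this[of n] show "z \<le> enat v" using bound[of "?a 0"] obj[of 0] z by simp
qed

section \<open>Ordered partitions as level sets\<close>

lemma sorted_list_of_set_strict_mono_image:
  fixes h :: "'a::linorder \<Rightarrow> 'b::linorder"
  assumes "finite A" "strict_mono_on A h"
  shows "sorted_list_of_set (h ` A) = map h (sorted_list_of_set A)"
proof (rule sorted_distinct_set_unique)
  show "sorted (map h (sorted_list_of_set A))"
    using assms strict_mono_on_imp_mono_on[OF assms(2)] by (intro sorted_map_mono) auto
  show "distinct (map h (sorted_list_of_set A))"
    using assms strict_mono_on_imp_inj_on[OF assms(2)] by (simp add: distinct_map)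
qed (use assms in auto)

text \<open>This is the ordered partition that \<open>braid_map\<close> records for one 1-cell, with
  the parameter function made a variable so that different configurations can be compared.\<close>

definition level_sets :: "'b set \<Rightarrow> ('b \<Rightarrow> 'c::linorder) \<Rightarrow> 'b set list" where
  "level_sets I f = map (\<lambda>s. {i \<in> I. f i = s}) (sorted_list_of_set (f ` I))"

text \<open>Since the comparisons agree, sending the value \<open>f i\<close> to \<open>g i\<close>
  is well defined and strictly increasing. It therefore matches the two sorted lists of values, and
  matching values have the same fibre.\<close>

lemma level_sets_eqI:
  fixes f g :: "'b \<Rightarrow> 'c::linorder"
  assumes fin: "finite I" and le: "\<And>i j. i \<in> I \<Longrightarrow> j \<in> I \<Longrightarrow> f i \<le> f j \<longleftrightarrow> g i \<le> g j"
  shows "level_sets I f = level_sets I g"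
proof -
  have eq: "f i = f j \<longleftrightarrow> g i = g j" if "i \<in> I" "j \<in> I" for i j
    using le[of i j] le[of j i] that by (auto simp: order_eq_iff)
  \<comment> \<open>The choice of the preimage is immaterial: by \<open>eq\<close>, all indices with
    the same value of \<open>f\<close> have the same value of \<open>g\<close>.\<close>
  define h where "h = (\<lambda>s. g (SOME i. i \<in> I \<and> f i = s))"
  have h: "h (f i) = g i" if "i \<in> I" for i
  proof -
    have "(SOME j. j \<in> I \<and> f j = f i) \<in> I \<and> f (SOME j. j \<in> I \<and> f j = f i) = f i"
      by (rule someI[of _ i]) (use that in simp)
    then show ?thesis using eq[of "SOME j. j \<in> I \<and> f j = f i" i] that unfolding h_def by blast
  qed
  have "strict_mono_on (f ` I) h"
    by (rule strict_mono_onI) (use le h in \<open>force simp: not_le[symmetric]\<close>)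
  moreover have "g ` I = h ` f ` I" using h by (force simp: image_iff)
  ultimately have "sorted_list_of_set (g ` I) = map h (sorted_list_of_set (f ` I))"
    using fin by (simp add: sorted_list_of_set_strict_mono_image)
  then show ?thesis
    unfolding level_sets_def using fin h eq by (auto simp: comp_def)
qed

text \<open>Translates the inequalities between blocks in \<open>braid_dom\<close> into inequalities
  between pairs of indices. It works because the position of a block is monotone in the value of
  \<open>f\<close> on it.\<close>

lemma level_sets_weakly_ordered:
  assumes fin: "finite I"
  shows "(\<forall>a b. a \<le> b \<and> b < length (level_sets I f) \<longrightarrow>
      (\<forall>i\<in>level_sets I f ! a. \<forall>j\<in>level_sets I f ! b. R i j)) \<longleftrightarrow>
    (\<forall>i\<in>I. \<forall>j\<in>I. f i \<le> f j \<longrightarrow> R i j)"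
proof -
  let ?xs = "sorted_list_of_set (f ` I)"
  have set: "set ?xs = f ` I" using fin by simp
  show ?thesis
  proof (intro iffI allI impI ballI)
    fix i j
    assume *: "\<forall>a b. a \<le> b \<and> b < length (level_sets I f) \<longrightarrow>
      (\<forall>i\<in>level_sets I f ! a. \<forall>j\<in>level_sets I f ! b. R i j)"
      and ij: "i \<in> I" "j \<in> I" "f i \<le> f j"
    obtain a b where ab: "a < length ?xs" "?xs ! a = f i" "b < length ?xs" "?xs ! b = f j"
      using set ij by (metis imageI in_set_conv_nth)
    show "R i j"
    proof (cases "a \<le> b")
      case True
      then show ?thesis using *[rule_format, of a b i j] ab ij by (simp add: level_sets_def)
    next
      case False
      \<comment> \<open>Together with \<open>f i \<le> f j\<close> this puts both indices into block
        \<open>a\<close>, so the instance with two equal block positions applies.\<close>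
      then have "f j \<le> f i"
        using sorted_nth_mono[of ?xs b a] ab by simp
      then show ?thesis using *[rule_format, of a a i j] ab ij by (simp add: level_sets_def)
    qed
  next
    fix a b i j
    assume *: "\<forall>i\<in>I. \<forall>j\<in>I. f i \<le> f j \<longrightarrow> R i j" and ab: "a \<le> b \<and> b < length (level_sets I f)"
      and ij: "i \<in> level_sets I f ! a" "j \<in> level_sets I f ! b"
    have "?xs ! a \<le> ?xs ! b" using ab by (intro sorted_nth_mono) (auto simp: level_sets_def)
    then show "R i j" using * ij ab by (auto simp: level_sets_def)
  qed
qed

section \<open>Segments in disks and interiors of cells\<close>

lemma open_unit_disk_subset_unit_disk: "open_unit_disk n \<subseteq> unit_disk n"
  by (auto simp: unit_disk_def open_unit_disk_def)

definition segment :: "('b \<Rightarrow> real) \<Rightarrow> ('b \<Rightarrow> real) \<Rightarrow> real \<Rightarrow> 'b \<Rightarrow> real" where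
  "segment t p s = (\<lambda>j. (1 - s) * t j + s * p j)"

lemma segment_0 [simp]: "segment t p 0 = t"
  by (simp add: segment_def)

lemma continuous_map_segment:
  assumes "t \<in> topspace (Euclidean_space n)" "p \<in> topspace (Euclidean_space n)"
  shows "continuous_map (top_of_set {0..1}) (Euclidean_space n) (segment t p)"
  unfolding Euclidean_space_def continuous_map_in_subtopology continuous_map_componentwise_UNIV
  using assms
  by (auto simp: segment_def topspace_Euclidean_space intro!: continuous_intros)

text \<open>The squared norm is convex, and at positive time the interior point \<open>p\<close> has
  positive weight, which makes the bound strict.\<close>

lemma segment_in_open_unit_disk:
  assumes t: "t \<in> unit_disk n" and p: "p \<in> open_unit_disk n" and s: "0 < s" "s \<le> 1"
  shows "segment t p s \<in> open_unit_disk n"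
proof -
  have convex: "((1 - s) * a + s * b)\<^sup>2 \<le> (1 - s) * a\<^sup>2 + s * b\<^sup>2" for a b :: real
  proof -
    have "(1 - s) * a\<^sup>2 + s * b\<^sup>2 - ((1 - s) * a + s * b)\<^sup>2 = (1 - s) * s * (a - b)\<^sup>2"
      by (simp add: power2_eq_square algebra_simps)
    moreover have "\<dots> \<ge> 0" using s by simp
    ultimately show ?thesis by linarith
  qed
  have "(\<Sum>i<n. (segment t p s i)\<^sup>2) \<le> (\<Sum>i<n. (1 - s) * (t i)\<^sup>2 + s * (p i)\<^sup>2)"
    unfolding segment_def by (intro sum_mono convex)
  also have "\<dots> = (1 - s) * (\<Sum>i<n. (t i)\<^sup>2) + s * (\<Sum>i<n. (p i)\<^sup>2)"
    by (simp add: sum.distrib sum_distrib_left)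
  also have "\<dots> < (1 - s) * 1 + s * 1"
  proof (rule add_le_less_mono)
    show "(1 - s) * (\<Sum>i<n. (t i)\<^sup>2) \<le> (1 - s) * 1"
      using t s by (intro mult_left_mono) (auto simp: unit_disk_def)
    show "s * (\<Sum>i<n. (p i)\<^sup>2) < s * 1"
      using p s by (intro mult_strict_left_mono) (auto simp: open_unit_disk_def)
  qed
  finally show ?thesis
    using t p by (auto simp: open_unit_disk_def unit_disk_def topspace_Euclidean_space segment_def)
qed

text \<open>The set where two continuous maps into a Hausdorff space agree is closed, and 0 is a
  limit of positive times. This carries identities from the interior of a domain to its
  boundary.\<close>

lemma continuous_maps_agree_at_0:
  fixes f g :: "real \<Rightarrow> 'b"
  assumes "Hausdorff_space Y"
    and "continuous_map (top_of_set {0..1}) Y f" "continuous_map (top_of_set {0..1}) Y g"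
    and "\<And>s. 0 < s \<Longrightarrow> s \<le> 1 \<Longrightarrow> f s = g s"
  shows "f 0 = g 0"
proof (rule forall_in_closure_of_eq[OF _ assms(1-3)])
  have "{0..1} \<inter> {0<..1::real} = {0<..1}" by auto
  then show "0 \<in> top_of_set {0..1::real} closure_of {0<..1}"
    by (simp add: closure_of_subtopology)
qed (use assms(4) in auto)

lemma cell_structureD:
  assumes "cell_structure X e n D \<phi>" and e: "e \<subseteq> topspace X"
  shows "open_unit_disk n \<subseteq> topspace D" and "topspace D \<subseteq> unit_disk n"
    and "continuous_map D (Euclidean_space n) (\<lambda>t. t)"
    and "continuous_map D X \<phi>"
    and "\<phi> ` topspace D \<subseteq> X closure_of e"
    and "\<phi> ` open_unit_disk n = e"
    and "inj_on \<phi> (open_unit_disk n)"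
    and "\<And>Z f. continuous_map Z (Euclidean_space n) f \<Longrightarrow> f ` topspace Z \<subseteq> topspace D \<Longrightarrow> continuous_map Z D f"
proof -
  obtain B where B: "open_unit_disk n \<subseteq> B" "B \<subseteq> unit_disk n" "D = subtopology (Euclidean_space n) B"
    and q: "quotient_map D (subtopology X (X closure_of e)) \<phi>"
    and h: "homeomorphic_map (subtopology (Euclidean_space n) (open_unit_disk n)) (subtopology X e) \<phi>"
    using assms by (auto simp: cell_structure_def)
  have sub: "unit_disk n \<subseteq> topspace (Euclidean_space n)" by (auto simp: unit_disk_def)
  have D: "topspace D = B" using B sub by auto
  have O: "topspace (subtopology (Euclidean_space n) (open_unit_disk n)) = open_unit_disk n"
    using sub open_unit_disk_subset_unit_disk[of n] by auto
  have "continuous_map D (subtopology X (X closure_of e)) \<phi>"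
    using q by (rule quotient_imp_continuous_map)
  then show "continuous_map D X \<phi>" and "\<phi> ` topspace D \<subseteq> X closure_of e"
    by (auto simp: continuous_map_in_subtopology)
  show "\<phi> ` open_unit_disk n = e"
    using homeomorphic_imp_surjective_map[OF h] e unfolding O by auto
  show "inj_on \<phi> (open_unit_disk n)"
    using homeomorphic_imp_injective_map[OF h] unfolding O .
  show "open_unit_disk n \<subseteq> topspace D" and "topspace D \<subseteq> unit_disk n"
    using B D by auto
  show "continuous_map D (Euclidean_space n) (\<lambda>t. t)"
    unfolding B by (rule continuous_map_from_subtopology) simp
  show "continuous_map Z D f" if "continuous_map Z (Euclidean_space n) f" "f ` topspace Z \<subseteq> topspace D" for Z f
    using that unfolding D unfolding B by (auto simp: continuous_map_in_subtopology)
qed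

text \<open>
  Along the radial path from a point \<open>t\<close> of the domain to the centre of the disk, the inverse
  homeomorphism undoes \<open>\<phi>\<close> at every positive time; if \<open>\<phi> t\<close> lies in the open cell, then by
  continuity it does so at time 0 as well.
\<close>

lemma cell_structure_interior:
  assumes cs: "cell_structure X e n D \<phi>" and e: "e \<subseteq> topspace X"
    and t: "t \<in> topspace D" "\<phi> t \<in> e"
  shows "t \<in> open_unit_disk n"
proof -
  note D = cell_structureD[OF cs e]
  let ?O = "subtopology (Euclidean_space n) (open_unit_disk n)"
  have t': "t \<in> unit_disk n" using t D(2) by auto
  then have tE: "t \<in> topspace (Euclidean_space n)" by (simp add: unit_disk_def)
  have 0: "(\<lambda>_. 0) \<in> open_unit_disk n"
    by (simp add: open_unit_disk_def topspace_Euclidean_space)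
  have "homeomorphic_map ?O (subtopology X e) \<phi>"
    using cs by (simp add: cell_structure_def)
  then obtain \<psi> where \<psi>: "homeomorphic_maps ?O (subtopology X e) \<phi> \<psi>"
    by (auto simp: homeomorphic_map_maps)
  then have \<psi>c: "continuous_map (subtopology X e) ?O \<psi>" and \<psi>i: "\<And>u. u \<in> open_unit_disk n \<Longrightarrow> \<psi> (\<phi> u) = u"
    by (auto simp: homeomorphic_maps_def open_unit_disk_def)
  let ?\<gamma> = "segment t (\<lambda>_. 0)"
  have \<gamma>: "?\<gamma> s \<in> open_unit_disk n" if "0 < s" "s \<le> 1" for s
    using segment_in_open_unit_disk[OF t' 0 that] .
  have \<gamma>c: "continuous_map (top_of_set {0..1}) (Euclidean_space n) ?\<gamma>"
    by (rule continuous_map_segment[OF tE]) (simp add: topspace_Euclidean_space)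
  have dom: "?\<gamma> s \<in> topspace D \<and> \<phi> (?\<gamma> s) \<in> e" if "s \<in> {0..1}" for s
  proof (cases "s = 0")
    case False
    then show ?thesis using \<gamma>[of s] that D(1,6) by auto
  qed (use t in simp)
  have "continuous_map (top_of_set {0..1}) D ?\<gamma>"
    using dom by (intro D(8)[OF \<gamma>c]) auto
  then have "continuous_map (top_of_set {0..1}) X (\<phi> \<circ> ?\<gamma>)"
    using D(4) by (rule continuous_map_compose)
  then have "continuous_map (top_of_set {0..1}) (subtopology X e) (\<phi> \<circ> ?\<gamma>)"
    using dom by (auto simp: continuous_map_in_subtopology)
  then have "continuous_map (top_of_set {0..1}) ?O (\<psi> \<circ> (\<phi> \<circ> ?\<gamma>))"
    using \<psi>c by (rule continuous_map_compose)
  then have c: "continuous_map (top_of_set {0..1}) (Euclidean_space n) (\<psi> \<circ> (\<phi> \<circ> ?\<gamma>))"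
    by (simp add: continuous_map_in_subtopology)
  have "(\<psi> \<circ> (\<phi> \<circ> ?\<gamma>)) 0 = ?\<gamma> 0"
    by (rule continuous_maps_agree_at_0[OF Hausdorff_Euclidean_space c \<gamma>c]) (simp add: \<psi>i \<gamma>)
  moreover have "\<psi> (\<phi> t) \<in> open_unit_disk n"
    using \<psi>c t(2) e by (auto simp: continuous_map_def)
  ultimately show ?thesis by simp
qed

lemma level_sets_cong:
  assumes "I = J" "\<And>i. i \<in> J \<Longrightarrow> f i = g i"
  shows "level_sets I f = level_sets J g"
proof -
  have "f ` I = g ` J" "\<And>s. {i \<in> I. f i = s} = {i \<in> J. g i = s}" using assms by auto
  then show ?thesis by (simp add: level_sets_def)
qed

section \<open>Vertices and edges of a one-dimensional cellular stratified space\<close>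

locale stratified_graph =
  fixes X :: "('a, 'l, nat \<Rightarrow> real) stratified_space"
  assumes cellular: "cellular_stratified_space X"
    and finite_cells: "finite_stratified X"
    and one_dim: "one_dimensional X"
begin

lemma dim_le_1: "l \<in> ss_index X \<Longrightarrow> ss_dim X l \<le> 1"
  using one_dim by (auto simp: one_dimensional_def)

lemma stratum_subset: "stratum X l \<subseteq> topspace (ss_space X)"
  by (auto simp: stratum_def)

lemma stratum_unique: "x \<in> stratum X l \<Longrightarrow> x \<in> stratum X m \<Longrightarrow> l = m"
  by (simp add: stratum_def)

lemma cell_structure:
  "l \<in> ss_index X \<Longrightarrow>
    cell_structure (ss_space X) (stratum X l) (ss_dim X l) (ss_dom X l) (ss_char X l)"
  using cellular by (simp add: cellular_stratified_space_def)

lemmas cellD = cell_structureD[OF cell_structure stratum_subset]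
lemmas cell_interior = cell_structure_interior[OF cell_structure stratum_subset]

lemma char_in_stratum:
  assumes "l \<in> ss_index X" "t \<in> open_unit_disk (ss_dim X l)"
  shows "ss_char X l t \<in> stratum X l"
  using cellD(6)[OF assms(1)] assms(2) by blast

lemma char_in_space:
  assumes "l \<in> ss_index X" "t \<in> topspace (ss_dom X l)"
  shows "ss_char X l t \<in> topspace (ss_space X)"
  using cellD(4)[OF assms(1)] assms(2) by (auto simp: continuous_map_def)

text \<open>In dimension 0 the sum of squares is empty, so the closed and the open disk
  coincide.\<close>

lemma vertex_interior:
  assumes "l \<in> ss_index X" "ss_dim X l = 0" "t \<in> topspace (ss_dom X l)"
  shows "t \<in> open_unit_disk (ss_dim X l)"
  using cellD(2)[OF assms(1)] assms(2,3) by (auto simp: unit_disk_def open_unit_disk_def)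

lemma vertex_stratum_unique:
  assumes "l \<in> ss_index X" "ss_dim X l = 0" "x \<in> stratum X l" "y \<in> stratum X l"
  shows "x = y"
proof -
  obtain t u where "t \<in> open_unit_disk 0" "x = ss_char X l t" "u \<in> open_unit_disk 0" "y = ss_char X l u"
    using assms cellD(6)[OF assms(1)] by (metis imageE)
  moreover from this have "t = u"
    by (auto simp: open_unit_disk_def topspace_Euclidean_space)
  ultimately show ?thesis by simp
qed

text \<open>A point of the closure of a cell outside the cell itself lies in a cell of smaller
  dimension. That is impossible if \<open>l\<close> is a vertex, which has no such boundary points,
  or if \<open>m\<close> is an edge, which already has the largest dimension.\<close>

lemma cell_of_char_point:
  assumes l: "l \<in> ss_index X" and m: "m \<in> ss_index X"
    and t: "t \<in> topspace (ss_dom X l)" "ss_char X l t \<in> stratum X m"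
    and dim: "ss_dim X l = 0 \<or> ss_dim X m = 1"
  shows "m = l"
proof (cases "ss_char X l t \<in> stratum X l")
  case True
  then show ?thesis using t(2) stratum_unique by blast
next
  case False
  then have pos: "ss_dim X l \<noteq> 0"
    using vertex_interior[OF l _ t(1)] char_in_stratum[OF l] by blast
  obtain F where F: "\<forall>m\<in>F. ss_dim X m < ss_dim X l"
      "ss_space X closure_of stratum X l - stratum X l \<subseteq> (\<Union>m\<in>F. stratum X m)"
    using cellular l by (auto simp: cellular_stratified_space_def)
  have "ss_char X l t \<in> ss_space X closure_of stratum X l"
    using cellD(5)[OF l] t(1) by blast
  then obtain m' where "m' \<in> F" "ss_char X l t \<in> stratum X m'" using F False by blast
  then have "ss_dim X m < ss_dim X l" using F t(2) stratum_unique by metis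
  then show ?thesis using dim pos dim_le_1[OF l] by auto
qed

section \<open>Interior points and domains of cells of the configuration space\<close>

text \<open>
  \<open>p\<close> is the preimage, under the characteristic map, of a point of the configuration space in
  the open braid cell \<open>(c, P)\<close>.
\<close>

definition interior_point ::
    "nat \<Rightarrow> (nat \<Rightarrow> 'l) \<Rightarrow> ('l \<Rightarrow> nat set list) \<Rightarrow> (nat \<Rightarrow> nat \<Rightarrow> real) \<Rightarrow> bool" where
  "interior_point k c P p \<longleftrightarrow>
     c \<in> {..<k} \<rightarrow>\<^sub>E ss_index X \<and>
     p \<in> (\<Pi>\<^sub>E i\<in>{..<k}. open_unit_disk (ss_dim X (c i))) \<and>
     (\<forall>i<k. \<forall>j<k. i \<noteq> j \<longrightarrow> ss_char X (c i) (p i) \<noteq> ss_char X (c j) (p j)) \<and>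
     P = (\<lambda>m\<in>cells_of_dim X 1. level_sets {i \<in> {..<k}. c i = m} (\<lambda>i. p i 0))"

text \<open>A cell indexed by \<open>comp_stratification\<close> contains a configuration by
  definition; its coordinates are pulled back through the characteristic maps, which are bijections
  from the open disks to the strata.\<close>

lemma interior_point_exists:
  assumes "(c, P) \<in> ss_index (comp_stratification k X)"
  obtains p where "interior_point k c P p"
proof -
  from assms obtain x where c: "c \<in> {..<k} \<rightarrow>\<^sub>E ss_index X"
    and x: "x \<in> Conf k (ss_space X)" and b: "braid_map k X x = (c, P)"
    by (auto simp: comp_stratification_def restrict_stratification_def braid_stratification_def
        Let_def stratum_def braid_index_def)
  have cx: "c i = ss_map X (x i)" if "i < k" for i
    using b that by (auto simp: braid_map_def)
  have ci: "c i \<in> ss_index X" if "i < k" for i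
    using c that by auto
  have xs: "x i \<in> stratum X (c i)" if "i < k" for i
    using x that cx by (auto simp: Conf_def power_space_def stratum_def)
  define p where
    "p = (\<lambda>i\<in>{..<k}. the_inv_into (open_unit_disk (ss_dim X (c i))) (ss_char X (c i)) (x i))"
  have p: "ss_char X (c i) (p i) = x i" "p i \<in> open_unit_disk (ss_dim X (c i))" if "i < k" for i
  proof -
    have im: "x i \<in> ss_char X (c i) ` open_unit_disk (ss_dim X (c i))"
      using cellD(6)[OF ci[OF that]] xs[OF that] by simp
    note inj = cellD(7)[OF ci[OF that]]
    show "ss_char X (c i) (p i) = x i"
      using f_the_inv_into_f[OF inj im] that by (simp add: p_def)
    show "p i \<in> open_unit_disk (ss_dim X (c i))"
      using the_inv_into_into[OF inj im order_refl] that by (simp add: p_def)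
  qed
  have "P = (\<lambda>m\<in>cells_of_dim X 1. level_sets {i \<in> {..<k}. c i = m} (\<lambda>i. p i 0))"
  proof
    fix m
    have P: "P = (\<lambda>m\<in>cells_of_dim X 1. level_sets {i \<in> {..<k}. ss_map X (x i) = m} (\<lambda>i. edge_param X m (x i)))"
      using b by (auto simp: braid_map_def level_sets_def Let_def)
    show "P m = (\<lambda>m\<in>cells_of_dim X 1. level_sets {i \<in> {..<k}. c i = m} (\<lambda>i. p i 0)) m"
    proof (cases "m \<in> cells_of_dim X 1")
      case True
      \<comment> \<open>\<open>edge_param\<close> inverts the same characteristic map on the same
        disk, because \<open>c i = m\<close> has dimension 1.\<close>
      then have "edge_param X m (x i) = p i 0" if "i < k" "c i = m" for i
        using that by (simp add: edge_param_def p_def cells_of_dim_def)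
      then have "level_sets {i \<in> {..<k}. ss_map X (x i) = m} (\<lambda>i. edge_param X m (x i))
          = level_sets {i \<in> {..<k}. c i = m} (\<lambda>i. p i 0)"
        using cx by (intro level_sets_cong) auto
      then show ?thesis using True by (simp add: P)
    qed (simp add: P)
  qed
  moreover have "p \<in> (\<Pi>\<^sub>E i\<in>{..<k}. open_unit_disk (ss_dim X (c i)))"
    using p(2) by (auto simp: p_def)
  ultimately have "interior_point k c P p"
    using c x p(1) by (auto simp: interior_point_def Conf_def)
  then show thesis by (rule that)
qed

text \<open>The interior point \<open>p\<close> serves as a reference for the order encoded by
  \<open>P\<close>: block conditions become comparisons of the parameters of \<open>p\<close>, so
  membership can be tested on pairs of coordinates.\<close>

lemma comp_dom_iff:
  assumes p: "interior_point k c P p"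
  shows "t \<in> topspace (ss_dom (comp_stratification k X) (c, P)) \<longleftrightarrow>
     t \<in> (\<Pi>\<^sub>E i\<in>{..<k}. topspace (ss_dom X (c i))) \<and>
     (\<forall>i<k. \<forall>j<k. i \<noteq> j \<longrightarrow> ss_char X (c i) (t i) \<noteq> ss_char X (c j) (t j)) \<and>
     (\<forall>i<k. \<forall>j<k. c i = c j \<and> ss_dim X (c i) = 1 \<and> p i 0 \<le> p j 0 \<longrightarrow> t i 0 \<le> t j 0)"
proof -
  let ?D = "\<Pi>\<^sub>E i\<in>{..<k}. topspace (ss_dom X (c i))"
  have c: "c i \<in> ss_index X" if "i < k" for i
    using p that by (auto simp: interior_point_def)
  have "(\<forall>m\<in>cells_of_dim X 1. \<forall>a b. a \<le> b \<and> b < length (P m) \<longrightarrow>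
             (\<forall>i\<in>P m ! a. \<forall>j\<in>P m ! b. t i 0 \<le> t j 0)) \<longleftrightarrow>
     (\<forall>m\<in>cells_of_dim X 1. \<forall>i\<in>{i \<in> {..<k}. c i = m}. \<forall>j\<in>{i \<in> {..<k}. c i = m}. p i 0 \<le> p j 0 \<longrightarrow> t i 0 \<le> t j 0)"
  proof (rule ball_cong[OF refl])
    fix m assume "m \<in> cells_of_dim X 1"
    then have P: "P m = level_sets {i \<in> {..<k}. c i = m} (\<lambda>i. p i 0)"
      using p by (simp add: interior_point_def)
    show "(\<forall>a b. a \<le> b \<and> b < length (P m) \<longrightarrow>
             (\<forall>i\<in>P m ! a. \<forall>j\<in>P m ! b. t i 0 \<le> t j 0)) \<longleftrightarrow>
        (\<forall>i\<in>{i \<in> {..<k}. c i = m}. \<forall>j\<in>{i \<in> {..<k}. c i = m}. p i 0 \<le> p j 0 \<longrightarrow> t i 0 \<le> t j 0)"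
      unfolding P by (rule level_sets_weakly_ordered) simp
  qed
  also have "\<dots> \<longleftrightarrow> (\<forall>i<k. \<forall>j<k. c i = c j \<and> ss_dim X (c i) = 1 \<and> p i 0 \<le> p j 0 \<longrightarrow> t i 0 \<le> t j 0)"
    (is "?L \<longleftrightarrow> ?R")
  proof
    assume L: ?L
    show ?R
    proof (intro allI impI)
      fix i j assume ij: "i < k" "j < k" "c i = c j \<and> ss_dim X (c i) = 1 \<and> p i 0 \<le> p j 0"
      then have "c i \<in> cells_of_dim X 1" using c[OF ij(1)] unfolding cells_of_dim_def by blast
      from bspec[OF L this] show "t i 0 \<le> t j 0" using ij by simp
    qed
  next
    assume R: ?R
    show ?L
    proof (intro ballI impI)
      fix m i j
      assume "m \<in> cells_of_dim X 1" "i \<in> {i \<in> {..<k}. c i = m}" "j \<in> {i \<in> {..<k}. c i = m}"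
        "p i 0 \<le> p j 0"
      then show "t i 0 \<le> t j 0" using R[rule_format, of i j] by (simp add: cells_of_dim_def)
    qed
  qed
  finally have order: "(\<forall>m\<in>cells_of_dim X 1. \<forall>a b. a \<le> b \<and> b < length (P m) \<longrightarrow>
             (\<forall>i\<in>P m ! a. \<forall>j\<in>P m ! b. t i 0 \<le> t j 0)) \<longleftrightarrow>
     (\<forall>i<k. \<forall>j<k. c i = c j \<and> ss_dim X (c i) = 1 \<and> p i 0 \<le> p j 0 \<longrightarrow> t i 0 \<le> t j 0)" .
  have "t \<in> topspace (ss_dom (comp_stratification k X) (c, P)) \<longleftrightarrow>
     t \<in> ?D \<and> (\<lambda>i\<in>{..<k}. ss_char X (c i) (t i)) \<in> Conf k (ss_space X) \<and>
     (\<forall>m\<in>cells_of_dim X 1. \<forall>a b. a \<le> b \<and> b < length (P m) \<longrightarrow>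
             (\<forall>i\<in>P m ! a. \<forall>j\<in>P m ! b. t i 0 \<le> t j 0))"
    by (auto simp: comp_stratification_def restrict_stratification_def braid_stratification_def
        Let_def braid_dom_def braid_char_def simp del: mem_Collect_eq) 
  \<comment> \<open>Characteristic maps take their values in the space, so only distinctness of the
    coordinates remains to be required.\<close>
  moreover have "(\<lambda>i\<in>{..<k}. ss_char X (c i) (t i)) \<in> Conf k (ss_space X) \<longleftrightarrow>
     (\<forall>i<k. \<forall>j<k. i \<noteq> j \<longrightarrow> ss_char X (c i) (t i) \<noteq> ss_char X (c j) (t j))" if "t \<in> ?D"
    using that c char_in_space by (auto simp: Conf_def power_space_def)
  ultimately show ?thesis unfolding order by blast
qed

lemma interior_pointD:
  assumes "interior_point k c P p" "i < k"
  shows "c i \<in> ss_index X" and "p i \<in> open_unit_disk (ss_dim X (c i))"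
    and "p i \<in> topspace (ss_dom X (c i))"
    and "ss_char X (c i) (p i) \<in> stratum X (c i)"
proof -
  show c: "c i \<in> ss_index X" and p: "p i \<in> open_unit_disk (ss_dim X (c i))"
    using assms by (auto simp: interior_point_def)
  then show "p i \<in> topspace (ss_dom X (c i))" "ss_char X (c i) (p i) \<in> stratum X (c i)"
    using cellD(1) char_in_stratum by blast+
qed

lemma interior_point_in_dom:
  assumes "interior_point k c P p"
  shows "p \<in> topspace (ss_dom (comp_stratification k X) (c, P))"
  unfolding comp_dom_iff[OF assms]
proof (intro conjI)
  have "p \<in> extensional {..<k}" using assms by (auto simp: interior_point_def PiE_def)
  then show "p \<in> (\<Pi>\<^sub>E i\<in>{..<k}. topspace (ss_dom X (c i)))"
    using interior_pointD(3)[OF assms] by (auto simp: PiE_def)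
  show "\<forall>i<k. \<forall>j<k. i \<noteq> j \<longrightarrow> ss_char X (c i) (p i) \<noteq> ss_char X (c j) (p j)"
    using assms unfolding interior_point_def by blast
qed simp

text \<open>A 0-cell is a single point and cannot hold two coordinates of a configuration. In
  dimension 1, points of the disk are determined by coordinate 0, all others being zero, so equal
  parameters would produce a collision.\<close>

lemma interior_point_same_cell:
  assumes p: "interior_point k c P p" and ij: "i < k" "j < k" "i \<noteq> j" "c i = c j"
  shows "ss_dim X (c i) = 1" and "p i 0 \<noteq> p j 0"
proof -
  note i = interior_pointD[OF p ij(1)] and j = interior_pointD[OF p ij(2)]
  have ne: "ss_char X (c i) (p i) \<noteq> ss_char X (c j) (p j)"
    using p ij(1-3) unfolding interior_point_def by blast
  then have "ss_dim X (c i) \<noteq> 0"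
    using vertex_stratum_unique[OF i(1)] i(4) j(4) ij(4) by auto
  then show dim: "ss_dim X (c i) = 1" using dim_le_1[OF i(1)] by simp
  show "p i 0 \<noteq> p j 0"
  proof
    assume "p i 0 = p j 0"
    then have "p i n = p j n" for n
      using i(2) j(2) ij(4) dim
      by (cases n) (auto simp: open_unit_disk_def topspace_Euclidean_space)
    then show False using ne ij(4) by (metis ext)
  qed
qed

section \<open>Straight paths in the domains, and continuity by coordinates\<close>

definition dom_path :: "nat \<Rightarrow> (nat \<Rightarrow> nat \<Rightarrow> real) \<Rightarrow> (nat \<Rightarrow> nat \<Rightarrow> real) \<Rightarrow> real \<Rightarrow> nat \<Rightarrow> nat \<Rightarrow> real" where
  "dom_path k t p s = (\<lambda>i\<in>{..<k}. segment (t i) (p i) s)"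

text \<open>The weak order conditions are convex, so the path preserves them. Collisions do not
  occur at positive time: coordinates in the same cell are strictly ordered by the contribution of
  \<open>p\<close>, and coordinates in different cells stay in disjoint strata.\<close>

lemma dom_path_interior:
  assumes p: "interior_point k c P p"
    and t: "t \<in> topspace (ss_dom (comp_stratification k X) (c, P))"
    and s: "0 < s" "s \<le> 1"
  shows "i < k \<Longrightarrow> dom_path k t p s i \<in> open_unit_disk (ss_dim X (c i))"
    and "dom_path k t p s \<in> topspace (ss_dom (comp_stratification k X) (c, P))"
proof -
  let ?u = "dom_path k t p s"
  note pD = interior_pointD[OF p]
  have tD: "t i \<in> topspace (ss_dom X (c i))" if "i < k" for i
    using t that unfolding comp_dom_iff[OF p] by auto
  have tle: "t i 0 \<le> t j 0" if "i < k" "j < k" "c i = c j" "ss_dim X (c i) = 1" "p i 0 \<le> p j 0" for i j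
    using t that unfolding comp_dom_iff[OF p] by blast
  show disk: "?u i \<in> open_unit_disk (ss_dim X (c i))" if "i < k" for i
    using segment_in_open_unit_disk[OF subsetD[OF cellD(2)[OF pD(1)] tD] pD(2) s] that
    by (simp add: dom_path_def)
  have u0: "?u i 0 = (1 - s) * t i 0 + s * p i 0" if "i < k" for i
    using that by (simp add: dom_path_def segment_def)
  have less: "?u i 0 < ?u j 0" if "i < k" "j < k" "c i = c j" "ss_dim X (c i) = 1" "p i 0 < p j 0" for i j
    unfolding u0[OF that(1)] u0[OF that(2)]
    using tle[of i j] that s by (intro add_le_less_mono mult_left_mono mult_strict_left_mono) auto
  have "ss_char X (c i) (?u i) \<noteq> ss_char X (c j) (?u j)" if "i < k" "j < k" "i \<noteq> j" for i j
  proof (cases "c i = c j")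
    case True
    note same = interior_point_same_cell[OF p that True]
    have "?u i \<noteq> ?u j"
      using less[of i j] less[of j i] that True same by fastforce
    then show ?thesis
      using inj_onD[OF cellD(7)[OF pD(1)[OF that(1)]]] disk[OF that(1)] disk[OF that(2)] True by auto
  next
    case False
    then show ?thesis
      using char_in_stratum[OF pD(1) disk] that stratum_unique by metis
  qed
  moreover have "?u i 0 \<le> ?u j 0" if "i < k" "j < k" "c i = c j" "ss_dim X (c i) = 1" "p i 0 \<le> p j 0" for i j
    unfolding u0[OF that(1)] u0[OF that(2)]
    using tle[of i j] that s by (intro add_mono mult_left_mono) auto
  moreover have "?u \<in> (\<Pi>\<^sub>E i\<in>{..<k}. topspace (ss_dom X (c i)))"
    using disk cellD(1)[OF pD(1)] by (auto simp: dom_path_def)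
  ultimately show "?u \<in> topspace (ss_dom (comp_stratification k X) (c, P))"
    unfolding comp_dom_iff[OF p] by blast
qed

text \<open>The domain arises by restricting a product topology twice. Presenting it as one
  restriction, to its own underlying set, separates continuity by coordinates from membership in the
  domain.\<close>

lemma comp_dom_eq:
  "ss_dom (comp_stratification k X) (c, P) =
     subtopology (product_topology (\<lambda>i. ss_dom X (c i)) {..<k})
       (topspace (ss_dom (comp_stratification k X) (c, P)))"
proof -
  have "\<exists>S. ss_dom (comp_stratification k X) (c, P) =
      subtopology (product_topology (\<lambda>i. ss_dom X (c i)) {..<k}) S"
    by (simp add: comp_stratification_def restrict_stratification_def braid_stratification_def
        Let_def braid_dom_def subtopology_subtopology) blast
  then obtain S where "ss_dom (comp_stratification k X) (c, P) =
      subtopology (product_topology (\<lambda>i. ss_dom X (c i)) {..<k}) S" ..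
  then show ?thesis by (metis subtopology_restrict topspace_subtopology)
qed

lemma continuous_map_comp_dom:
  assumes "\<And>i. i < k \<Longrightarrow> continuous_map Z (ss_dom X (c i)) (\<lambda>z. f z i)"
    and f: "f ` topspace Z \<subseteq> topspace (ss_dom (comp_stratification k X) (c, P))"
  shows "continuous_map Z (ss_dom (comp_stratification k X) (c, P)) f"
proof -
  have "topspace (ss_dom (comp_stratification k X) (c, P)) \<subseteq> extensional {..<k}"
    by (subst comp_dom_eq) (auto simp: PiE_def)
  then have "f ` topspace Z \<subseteq> extensional {..<k}" using f by (rule order_trans[rotated])
  then have "continuous_map Z (product_topology (\<lambda>i. ss_dom X (c i)) {..<k}) f"
    using assms(1) by (simp add: continuous_map_componentwise)
  then show ?thesis
    using f by (subst comp_dom_eq) (auto simp: continuous_map_in_subtopology)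
qed

lemma continuous_map_comp_dom_coordinate:
  assumes "i < k"
  shows "continuous_map (ss_dom (comp_stratification k X) (c, P)) (ss_dom X (c i)) (\<lambda>t. t i)"
  using assms
  by (subst comp_dom_eq) (auto intro!: continuous_map_from_subtopology continuous_map_product_projection)

section \<open>Vertex coordinates under face morphisms\<close>

text \<open>The cardinality of this set is the rank used in \<open>dim_BC_le\<close>.\<close>

definition vertex_coords :: "nat \<Rightarrow> (nat \<Rightarrow> 'l) \<Rightarrow> nat set" where
  "vertex_coords k c = {i \<in> {..<k}. ss_dim X (c i) = 0}"

text \<open>Distinct coordinates sharing a cell force that cell to have dimension 1, so
  \<open>c\<close> is injective on the vertex coordinates.\<close>

lemma card_vertex_coords_le:
  assumes p: "interior_point k c P p"
  shows "card (vertex_coords k c) \<le> num_vertices X"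
  unfolding num_vertices_def
proof (rule card_inj_on_le)
  show "inj_on c (vertex_coords k c)"
  proof (rule inj_onI, rule ccontr)
    fix i j assume "i \<in> vertex_coords k c" "j \<in> vertex_coords k c" "c i = c j" "i \<noteq> j"
    then show False
      using interior_point_same_cell(1)[OF p, of i j] by (simp add: vertex_coords_def)
  qed
  show "c ` vertex_coords k c \<subseteq> cells_of_dim X 0"
    using interior_pointD(1)[OF p] by (auto simp: vertex_coords_def cells_of_dim_def)
  show "finite (cells_of_dim X 0)"
    using finite_cells by (auto simp: finite_stratified_def cells_of_dim_def)
qed

lemma face_liftD:
  assumes p: "interior_point k c P p" and q: "interior_point k c' P' q"
    and b: "b \<in> face_lifts (comp_stratification k X) (c, P) (c', P')"
    and t: "t \<in> topspace (ss_dom (comp_stratification k X) (c, P))"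
  shows "b t \<in> topspace (ss_dom (comp_stratification k X) (c', P'))"
    and "i < k \<Longrightarrow> b t i \<in> topspace (ss_dom X (c' i))"
    and "i < k \<Longrightarrow> ss_char X (c' i) (b t i) = ss_char X (c i) (t i)"
proof -
  let ?S = "comp_stratification k X"
  have "continuous_map (ss_dom ?S (c, P)) (ss_dom ?S (c', P')) b"
    and ch: "ss_char ?S (c', P') (b t) = ss_char ?S (c, P) t"
    using b t by (auto simp: face_lifts_def)
  then show bt: "b t \<in> topspace (ss_dom ?S (c', P'))"
    using t by (auto simp: continuous_map_def)
  show "b t i \<in> topspace (ss_dom X (c' i))" if "i < k"
    using bt that unfolding comp_dom_iff[OF q] by auto
  have "ss_char ?S = braid_char k X"
    by (simp add: comp_stratification_def restrict_stratification_def braid_stratification_def Let_def)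
  then have "braid_char k X (c', P') (b t) i = braid_char k X (c, P) t i" using ch by simp
  then show "ss_char X (c' i) (b t i) = ss_char X (c i) (t i)" if "i < k"
    using that by (simp add: braid_char_def)
qed

text \<open>Evaluate the lift at the interior point \<open>p\<close>: coordinate \<open>i\<close> of
  \<open>b p\<close> is a point of the domain of \<open>c' i\<close> whose image lies in the open
  cell \<open>c i\<close>, so \<open>cell_of_char_point\<close> applies.\<close>

lemma face_lift_cell_eq:
  assumes p: "interior_point k c P p" and q: "interior_point k c' P' q"
    and b: "b \<in> face_lifts (comp_stratification k X) (c, P) (c', P')"
    and i: "i < k" "ss_dim X (c' i) = 0 \<or> ss_dim X (c i) = 1"
  shows "c i = c' i"
proof -
  note lift = face_liftD[OF p q b interior_point_in_dom[OF p]]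
  show ?thesis
    using cell_of_char_point[OF interior_pointD(1)[OF q] interior_pointD(1)[OF p] lift(2) _ i(2)]
      lift(3) interior_pointD(4)[OF p] i(1) by simp
qed

lemma face_lift_same_vertices:
  assumes p: "interior_point k c P p" and q: "interior_point k c' P' q"
    and b: "b \<in> face_lifts (comp_stratification k X) (c, P) (c', P')"
    and v: "vertex_coords k c' = vertex_coords k c"
  shows "c' = c" and "P' = P"
    and "b = (\<lambda>t\<in>topspace (ss_dom (comp_stratification k X) (c, P)). t)"
proof -
  let ?S = "comp_stratification k X"
  note pD = interior_pointD[OF p] and lift = face_liftD[OF p q b]
  have "c i = c' i" if "i < k" for i
  proof (rule face_lift_cell_eq[OF p q b that])
    have "ss_dim X (c' i) = 0 \<longleftrightarrow> ss_dim X (c i) = 0"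
      using v that by (auto simp: vertex_coords_def set_eq_iff)
    then show "ss_dim X (c' i) = 0 \<or> ss_dim X (c i) = 1"
      using dim_le_1[OF pD(1)[OF that]] by linarith
  qed
  moreover have "c \<in> extensional {..<k}" "c' \<in> extensional {..<k}"
    using p q by (auto simp: interior_point_def PiE_def)
  ultimately show c: "c' = c" by (intro extensionalityI[of _ "{..<k}"]) auto
  \<comment> \<open>The characteristic map is injective only on the open disk, so
    \<open>b u i\<close> must first be placed there; \<open>cell_interior\<close> does this because
    its image lies in the open cell.\<close>
  have fix_coord: "b u i = u i" if u: "u \<in> topspace (ss_dom ?S (c, P))" and i: "i < k"
    and disk: "u i \<in> open_unit_disk (ss_dim X (c i))" for u i
  proof -
    have ch: "ss_char X (c i) (b u i) = ss_char X (c i) (u i)" using lift(3)[OF u i] c by simp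
    then have "b u i \<in> open_unit_disk (ss_dim X (c i))"
      using cell_interior[OF pD(1)[OF i]] lift(2)[OF u i] char_in_stratum[OF pD(1)[OF i] disk] c
      by simp
    then show ?thesis using inj_onD[OF cellD(7)[OF pD(1)[OF i]], OF ch] disk by blast
  qed
  \<comment> \<open>The point \<open>b p\<close> obeys the inequalities of \<open>P'\<close>, whose
    reference point is \<open>q\<close>, while its coordinates are those of
    \<open>p\<close>.\<close>
  have order: "p i 0 \<le> p j 0" if "i < k" "j < k" "c i = c j" "ss_dim X (c i) = 1" "q i 0 \<le> q j 0" for i j
  proof -
    note pp = interior_point_in_dom[OF p]
    have "b p i 0 \<le> b p j 0"
      using lift(1)[OF pp] that c unfolding comp_dom_iff[OF q] by blast
    then show ?thesis using fix_coord[OF pp] pD(2) that by simp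
  qed
  \<comment> \<open>The converse comes from totality: if the order of \<open>q\<close> were
    opposite, \<open>order\<close> would force two equal parameters of \<open>p\<close> in one
    cell.\<close>
  have order_iff: "q i 0 \<le> q j 0 \<longleftrightarrow> p i 0 \<le> p j 0" if "i < k" "j < k" "c i = c j" "ss_dim X (c i) = 1" for i j
  proof (cases "i = j")
    case False
    then show ?thesis
      using order[of i j] order[of j i] interior_point_same_cell(2)[OF p, of i j] that by force
  qed simp
  have "level_sets {i \<in> {..<k}. c i = m} (\<lambda>i. q i 0) = level_sets {i \<in> {..<k}. c i = m} (\<lambda>i. p i 0)"
    if "m \<in> cells_of_dim X 1" for m
    using order_iff that by (intro level_sets_eqI) (auto simp: cells_of_dim_def)
  then show P: "P' = P"
    using p q unfolding interior_point_def c by (simp add: restrict_def fun_eq_iff)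
  \<comment> \<open>A coordinate of \<open>t\<close> may be an endpoint of an edge, where
    \<open>fix_coord\<close> is silent. The path towards \<open>p\<close> has all coordinates in
    open disks at positive times, and \<open>t\<close> is its limit at time 0.\<close>
  have "b t = t" if t: "t \<in> topspace (ss_dom ?S (c, P))" for t
  proof (rule PiE_ext)
    show "b t \<in> (\<Pi>\<^sub>E i\<in>{..<k}. topspace (ss_dom X (c i)))"
      using lift(1)[OF t] unfolding comp_dom_iff[OF q] unfolding c by blast
    show tD: "t \<in> (\<Pi>\<^sub>E i\<in>{..<k}. topspace (ss_dom X (c i)))"
      using t unfolding comp_dom_iff[OF p] by blast
    fix i assume "i \<in> {..<k}"
    then have i: "i < k" by simp
    let ?\<gamma> = "dom_path k t p"
    have \<gamma>0: "?\<gamma> 0 = t" using tD by (auto simp: dom_path_def PiE_def extensional_restrict)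
    have \<gamma>_dom: "?\<gamma> s \<in> topspace (ss_dom ?S (c, P))" if "s \<in> {0..1}" for s
      using dom_path_interior(2)[OF p t, of s] \<gamma>0 t that by (cases "s = 0") auto
    have \<gamma>_coord: "continuous_map (top_of_set {0..1}) (ss_dom X (c j)) (\<lambda>s. ?\<gamma> s j)" if "j < k" for j
    proof (rule cellD(8)[OF pD(1)[OF that]])
      have "t j \<in> topspace (Euclidean_space (ss_dim X (c j)))"
        "p j \<in> topspace (Euclidean_space (ss_dim X (c j)))"
        using tD cellD(2)[OF pD(1)[OF that]] pD(2)[OF that] that
        by (auto simp: unit_disk_def open_unit_disk_def)
      from continuous_map_segment[OF this]
      show "continuous_map (top_of_set {0..1}) (Euclidean_space (ss_dim X (c j))) (\<lambda>s. ?\<gamma> s j)"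
        using that by (simp add: dom_path_def)
      show "(\<lambda>s. ?\<gamma> s j) ` topspace (top_of_set {0..1}) \<subseteq> topspace (ss_dom X (c j))"
        using \<gamma>_dom that unfolding comp_dom_iff[OF p] by (auto simp: PiE_iff)
    qed
    have "continuous_map (top_of_set {0..1}) (ss_dom ?S (c, P)) ?\<gamma>"
      using \<gamma>_coord \<gamma>_dom by (intro continuous_map_comp_dom) auto
    moreover have "continuous_map (ss_dom ?S (c, P)) (ss_dom ?S (c, P)) b"
      using b c P by (simp add: face_lifts_def)
    ultimately have "continuous_map (top_of_set {0..1}) (ss_dom ?S (c, P)) (b \<circ> ?\<gamma>)"
      by (rule continuous_map_compose)
    from continuous_map_compose[OF this continuous_map_comp_dom_coordinate[OF i]]
    have "continuous_map (top_of_set {0..1}) (ss_dom X (c i)) (\<lambda>s. b (?\<gamma> s) i)"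
      by (simp add: comp_def)
    from continuous_map_compose[OF this cellD(3)[OF pD(1)[OF i]]]
    have bc: "continuous_map (top_of_set {0..1}) (Euclidean_space (ss_dim X (c i))) (\<lambda>s. b (?\<gamma> s) i)"
      by (simp add: comp_def)
    from continuous_map_compose[OF \<gamma>_coord[OF i] cellD(3)[OF pD(1)[OF i]]]
    have \<gamma>c: "continuous_map (top_of_set {0..1}) (Euclidean_space (ss_dim X (c i))) (\<lambda>s. ?\<gamma> s i)"
      by (simp add: comp_def)
    \<comment> \<open>The limit is taken in one Euclidean factor at a time, where the Hausdorff
      property is available.\<close>
    have "b (?\<gamma> 0) i = ?\<gamma> 0 i"
    proof (rule continuous_maps_agree_at_0[OF Hausdorff_Euclidean_space bc \<gamma>c])
      fix s :: real assume "0 < s" "s \<le> 1"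
      note \<gamma> = dom_path_interior[OF p t this]
      show "b (?\<gamma> s) i = ?\<gamma> s i" by (rule fix_coord[OF \<gamma>(2) i \<gamma>(1)[OF i]])
    qed
    then show "b t i = t i" by (simp add: \<gamma>0)
  qed
  moreover have "b \<in> extensional (topspace (ss_dom ?S (c, P)))"
    using b by (simp add: face_lifts_def)
  ultimately show "b = (\<lambda>t\<in>topspace (ss_dom ?S (c, P)). t)"
    by (auto simp: fun_eq_iff extensional_def)
qed

lemma dim_BC_comp_le: "dim_BC (face_category (comp_stratification k X)) \<le> enat (num_vertices X)"
proof (rule dim_BC_le[OF small_category_face_category, where r = "\<lambda>x. card (vertex_coords k (fst x))"])
  let ?C = "face_category (comp_stratification k X)"
  have obj: "cat_obj ?C = ss_index (comp_stratification k X)" by (simp add: face_category_def)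
  show "card (vertex_coords k (fst x)) \<le> num_vertices X" if "x \<in> cat_obj ?C" for x
    using that unfolding obj
    by (metis card_vertex_coords_le interior_point_exists prod.collapse)
  fix x y f assume xy: "x \<in> cat_obj ?C" "y \<in> cat_obj ?C" and f: "f \<in> cat_hom ?C x y"
  obtain c P c' P' where x: "x = (c, P)" and y: "y = (c', P')" by (metis surj_pair)
  obtain p q where p: "interior_point k c P p" and q: "interior_point k c' P' q"
    using xy unfolding obj x y by (metis interior_point_exists)
  obtain b where fb: "f = (x, y, b)" and b: "b \<in> face_lifts (comp_stratification k X) (c, P) (c', P')"
    using f by (auto simp: face_category_def cat_hom_def x y)
  \<comment> \<open>A coordinate may leave a vertex along a morphism but never enter one: a vertex
    as the target cell forces the source cell to be the same vertex.\<close>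
  have sub: "vertex_coords k c' \<subseteq> vertex_coords k c"
  proof
    fix i assume "i \<in> vertex_coords k c'"
    then have "i < k" "ss_dim X (c' i) = 0" by (simp_all add: vertex_coords_def)
    then show "i \<in> vertex_coords k c"
      using face_lift_cell_eq[OF p q b, of i] by (simp add: vertex_coords_def)
  qed
  have fin: "finite (vertex_coords k c)" by (simp add: vertex_coords_def)
  show "card (vertex_coords k (fst y)) < card (vertex_coords k (fst x)) \<or> x = y \<and> f = cat_id ?C x"
  \<comment> \<open>Equality of the two sets makes the lift an identity; otherwise the inclusion is
    proper and the rank drops.\<close>
  proof (cases "vertex_coords k c' = vertex_coords k c")
    case True
    note same = face_lift_same_vertices[OF p q b True]
    show ?thesis using same by (simp add: x y fb face_category_def)
  next
    case False
    then show ?thesis using psubset_card_mono[OF fin] sub by (auto simp: x y)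
  qed
qed

end

theorem theorem1p5:
  fixes X :: "('a, 'l, nat \<Rightarrow> real) stratified_space"
    and k :: nat
  assumes "cellular_stratified_space X"
    and "finite_stratified X"
    and "one_dimensional X"
    and "connected_space (ss_space X)"
    and "k > 0"
  shows "dim_BC (face_category (comp_stratification k X)) \<le> enat (num_vertices X)"
proof -
  interpret stratified_graph X
    using assms(1-3) by unfold_locales
  show ?thesis by (rule dim_BC_comp_le)
qed

end
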